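(* Let $\Delta\in\mathbb{R}$ and let $$F_2(\delta)=\sum_{n=0}^\infty\sum_{p\in\mathbb{Z}}a_{n,p}\,e^{-2\pi(\Delta+n)\delta_1+2\pi i p\delta_2},\qquad a_{n,p}=a_{n,-p}^*,$$ be a real form on the half plane $\{\delta=\delta_1+i\delta_2:\delta_1>0\}$ (the series converging there) which is a modular invariant, that is, $F_2(1/\delta)=F_2(\delta)=F_2(\delta+i)$. Let $\alpha>0$. Then $$F_{2a}^\alpha(\delta)=\sum_{n=0}^\infty\sum_{p\in\mathbb{Z}}a_{n,p}\,e^{-\frac1{2\alpha}\left(\sqrt{1+8\pi(\Delta+n)\alpha\delta_1+(4\pi p\alpha\delta_1)^2}-1\right)+2\pi i p\delta_2}$$ is also modular invariant, that is, $F_{2a}^\alpha(1/\delta)=F_{2a}^\alpha(\delta)=F_{2a}^\alpha(\delta+i)$, where, if $\Delta<0$, $\delta$ is restricted to $8\pi|\Delta|\alpha<\operatorname{Re}\delta<(8\pi|\Delta|\alpha)^{-1}$.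
   Context: Here $\delta=\delta_1+i\delta_2$ with $\delta_1,\delta_2$ real and $\delta_1=\operatorname{Re}\delta>0$; it is related to the usual modulus by $\tau=i\delta$. The star denotes complex conjugation, so the condition $a_{n,p}=a_{n,-p}^*$ makes $F_2$ real-valued. "Real form" means no holomorphy in $\delta$ is assumed.
   Formalization: Convergence is read as absolute; since the series for F_{2a}^α can diverge for a modular invariant F_2 (even with Δ=0), F_{2a}^α(1/δ)=F_{2a}^α(δ) is asserted where the series converges at both δ and 1/δ, and invariance under δ→δ+i where it converges at δ. *)

theory Defs
  imports "HOL-Analysis.Analysis"
begin

text \<open>
  Double series over \<open>n \<ge> 0\<close> and \<open>p \<in> \<int>\<close> are unordered sums over pairs \<open>(n, p)\<close>; for complex
  terms their convergence (\<^term>\<open>(summable_on)\<close>) is absolute convergence.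
\<close>

definition F2_term :: "real \<Rightarrow> (nat \<Rightarrow> int \<Rightarrow> complex) \<Rightarrow> complex \<Rightarrow> nat \<times> int \<Rightarrow> complex" where
  "F2_term \<Delta> a \<delta> = (\<lambda>(n, p). a n p *
     exp (complex_of_real (- 2 * pi * (\<Delta> + real n) * Re \<delta>)
          + 2 * complex_of_real pi * \<i> * of_int p * complex_of_real (Im \<delta>)))"

definition F2 :: "real \<Rightarrow> (nat \<Rightarrow> int \<Rightarrow> complex) \<Rightarrow> complex \<Rightarrow> complex" where
  "F2 \<Delta> a \<delta> = infsum (F2_term \<Delta> a \<delta>) UNIV"

definition F2a_term ::
  "real \<Rightarrow> real \<Rightarrow> (nat \<Rightarrow> int \<Rightarrow> complex) \<Rightarrow> complex \<Rightarrow> nat \<times> int \<Rightarrow> complex" where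
  "F2a_term \<alpha> \<Delta> a \<delta> = (\<lambda>(n, p). a n p *
     exp (complex_of_real (- (1 / (2 * \<alpha>)) *
            (sqrt (1 + 8 * pi * (\<Delta> + real n) * \<alpha> * Re \<delta>
                     + (4 * pi * of_int p * \<alpha> * Re \<delta>)^2) - 1))
          + 2 * complex_of_real pi * \<i> * of_int p * complex_of_real (Im \<delta>)))"

text \<open>
  Convergence of the series defining \<open>F2a\<close> is not automatic: the coefficients of an invariant
  \<open>F2\<close> may grow like \<open>exp (c \<surd>n)\<close> even when \<open>\<Delta> = 0\<close>. Since \<^term>\<open>infsum\<close> is \<open>0\<close> for a divergent
  series, an equation between values of \<open>F2a\<close> is meaningful only where the series converges.
\<close>

definition F2a :: "real \<Rightarrow> real \<Rightarrow> (nat \<Rightarrow> int \<Rightarrow> complex) \<Rightarrow> complex \<Rightarrow> complex" where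
  "F2a \<alpha> \<Delta> a \<delta> = infsum (F2a_term \<alpha> \<Delta> a \<delta>) UNIV"

text \<open>
  The set to which \<open>\<delta>\<close> is restricted. For \<open>\<Delta> < 0\<close> it is a strip that is not mapped into itself by
  \<open>\<delta> \<mapsto> 1/\<delta>\<close>, but every \<open>\<delta>\<close> in it satisfies
  \<open>Re (1/\<delta>) \<le> 1 / Re \<delta> < (8\<pi>\<bar>\<Delta>\<bar>\<alpha>)\<^sup>-\<^sup>1\<close>, so all square roots in \<^const>\<open>F2a_term\<close> are taken
  of positive numbers at \<open>1/\<delta>\<close> as well.
\<close>

definition F2a_domain :: "real \<Rightarrow> real \<Rightarrow> complex set" where
  "F2a_domain \<alpha> \<Delta> = {\<delta>. Re \<delta> > 0 \<and>
     (\<Delta> < 0 \<longrightarrow> 8 * pi * \<bar>\<Delta>\<bar> * \<alpha> < Re \<delta> \<and> Re \<delta> < inverse (8 * pi * \<bar>\<Delta>\<bar> * \<alpha>))}"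

end

theory Submission
  imports Defs "HOL-Probability.Probability"
begin

text \<open>
  Up to the factor \<open>4\<pi>\<alpha>\<close>, \<open>F2a\<close> is the integral of \<open>F2 z\<close> against the kernel
  \<open>exp (-|z - \<delta>|\<^sup>2 / (4\<alpha> Re z Re \<delta>))\<close> and the invariant measure \<open>dx dy / x\<^sup>2\<close> of the half plane \<open>z = x + iy\<close>.
  The kernel is unchanged under simultaneous inversion of \<open>z\<close> and \<open>\<delta>\<close>, so \<open>F2a\<close> inherits the
  invariance of \<open>F2\<close>. Modularity gives \<open>|F2 z| \<le> C exp (2\<pi> max 0 (-\<Delta>) max (x, 1/x))\<close>, and the strip
  condition on \<open>\<delta>\<close> is exactly what makes the kernel beat this growth at \<open>x \<rightarrow> \<infinity>\<close> and \<open>x \<rightarrow> 0\<close>.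
\<close>

section \<open>Fourier transforms of Gaussians\<close>

text \<open>The integral is the characteristic function of the standard normal distribution, with
  its density moved into the integrand.\<close>

lemma gaussian_fourier_std:
  "has_bochner_integral lborel
     (\<lambda>v. complex_of_real (std_normal_density v) * iexp (t * v)) (complex_of_real (exp (- (t\<^sup>2) / 2)))"
proof -
  interpret real_distribution std_normal_distribution by (rule real_dist_normal_dist)
  have "integrable std_normal_distribution (\<lambda>x. iexp (t * x))"
    using integrable_iexp[of "\<lambda>x. complex_of_real (t * x)"] by simp
  then have "integrable lborel (\<lambda>v. complex_of_real (std_normal_density v) * iexp (t * v))"
    by (subst (asm) integrable_density) (auto simp: scaleR_conv_of_real)
  moreover have "(CLINT v|lborel. complex_of_real (std_normal_density v) * iexp (t * v))
      = char std_normal_distribution t"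
    unfolding char_def by (subst integral_density) (auto simp: scaleR_conv_of_real)
  ultimately show ?thesis
    unfolding char_std_normal_distribution has_bochner_integral_iff by simp
qed

text \<open>The substitution \<open>v = (x * u - d) / \<sigma>\<close> with variance
  \<open>q / 2\<close> reduces this to the standard normal case. It evaluates the
  \<open>u\<close>-integral at fixed \<open>s\<close>, where \<open>x = exp s\<close>,
  \<open>d = Im \<delta>\<close> and \<open>t = 2 * pi * p\<close>; the factor
  \<open>exp (- (t\<^sup>2 * q / 4))\<close> then supplies the \<open>p\<close>-dependence under the
  square root of \<open>F2a_term\<close>.\<close>

lemma gaussian_fourier:
  fixes x q d t :: real
  assumes "x > 0" "q > 0"
  shows "has_bochner_integral lborel
     (\<lambda>u. exp (complex_of_real (- ((x * u - d)\<^sup>2) / q) + \<i> * complex_of_real (t * (x * u))))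
     (exp (\<i> * complex_of_real (t * d)) * complex_of_real (sqrt (pi * q) / x * exp (- (t\<^sup>2 * q / 4))))"
proof -
  define \<sigma> where "\<sigma> = sqrt (q / 2)"
  have \<sigma>: "\<sigma> > 0" "\<sigma>\<^sup>2 = q / 2"
    using assms by (auto simp: \<sigma>_def)
  have "has_bochner_integral lborel
     (\<lambda>v. complex_of_real (std_normal_density v) * iexp (t * \<sigma> * v)) (complex_of_real (exp (- ((t * \<sigma>)\<^sup>2) / 2)))"
    by (rule gaussian_fourier_std)
  then have "has_bochner_integral lborel
     (\<lambda>u. complex_of_real (std_normal_density (- (d / \<sigma>) + x / \<sigma> * u)) * iexp (t * \<sigma> * (- (d / \<sigma>) + x / \<sigma> * u)))
      (complex_of_real (exp (- ((t * \<sigma>)\<^sup>2) / 2)) /\<^sub>R \<bar>x / \<sigma>\<bar>)"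
    by (subst (asm) lborel_has_bochner_integral_real_affine_iff[where c = "x / \<sigma>" and t = "- (d / \<sigma>)"])
       (use assms \<sigma> in auto)
  then have *: "has_bochner_integral lborel
     (\<lambda>u. (complex_of_real (sqrt (2 * pi)) * exp (\<i> * complex_of_real (t * d))) *
        (complex_of_real (std_normal_density (- (d / \<sigma>) + x / \<sigma> * u)) * iexp (t * \<sigma> * (- (d / \<sigma>) + x / \<sigma> * u))))
      ((complex_of_real (sqrt (2 * pi)) * exp (\<i> * complex_of_real (t * d))) *
        (complex_of_real (exp (- ((t * \<sigma>)\<^sup>2) / 2)) /\<^sub>R \<bar>x / \<sigma>\<bar>))"
    by (rule has_bochner_integral_mult_right)
  have eq: "(complex_of_real (sqrt (2 * pi)) * exp (\<i> * complex_of_real (t * d))) *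
        (complex_of_real (std_normal_density (- (d / \<sigma>) + x / \<sigma> * u)) * iexp (t * \<sigma> * (- (d / \<sigma>) + x / \<sigma> * u)))
      = exp (complex_of_real (- ((x * u - d)\<^sup>2) / q) + \<i> * complex_of_real (t * (x * u)))" for u
  proof -
    have v: "- (d / \<sigma>) + x / \<sigma> * u = (x * u - d) / \<sigma>"
      by (simp add: diff_divide_distrib)
    have "sqrt (2 * pi) * std_normal_density ((x * u - d) / \<sigma>) = exp (- ((x * u - d)\<^sup>2) / q)"
      using \<sigma> by (simp add: std_normal_density_def power_divide)
    then have f1: "complex_of_real (sqrt (2 * pi)) * complex_of_real (std_normal_density ((x * u - d) / \<sigma>))
       = exp (complex_of_real (- ((x * u - d)\<^sup>2) / q))"
      by (metis exp_of_real of_real_mult)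
    have f2: "exp (\<i> * complex_of_real (t * d)) * iexp (t * \<sigma> * ((x * u - d) / \<sigma>))
        = exp (\<i> * complex_of_real (t * (x * u)))"
    proof -
      have "\<i> * complex_of_real (t * d) + \<i> * complex_of_real (t * \<sigma> * ((x * u - d) / \<sigma>))
          = \<i> * complex_of_real (t * d + t * (x * u - d))"
        using \<sigma> by (simp only: of_real_add distrib_left) simp
      then show ?thesis
        by (simp only: exp_add[symmetric]) (simp add: right_diff_distrib)
    qed
    have r: "(a * b) * (c * e) = (a * c) * (b * e)" for a b c e :: complex
      by (simp only: ac_simps)
    show ?thesis
      unfolding v exp_add by (subst r) (simp only: f1 f2)
  qed
  have sq: "sqrt (2 * pi) * \<sigma> = sqrt (pi * q)"
    unfolding \<sigma>_def by (simp flip: real_sqrt_mult)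
  have "(complex_of_real (sqrt (2 * pi)) * exp (\<i> * complex_of_real (t * d))) *
        (complex_of_real (exp (- ((t * \<sigma>)\<^sup>2) / 2)) /\<^sub>R \<bar>x / \<sigma>\<bar>)
      = exp (\<i> * complex_of_real (t * d)) * complex_of_real (sqrt (2 * pi) * \<sigma> / x * exp (- ((t * \<sigma>)\<^sup>2) / 2))"
    using assms \<sigma>(1) by (simp add: scaleR_conv_of_real)
  also have "\<dots> = exp (\<i> * complex_of_real (t * d)) * complex_of_real (sqrt (pi * q) / x * exp (- (t\<^sup>2 * q / 4)))"
    unfolding sq by (simp add: power_mult_distrib \<sigma>)
  finally show ?thesis
    using * unfolding eq by simp
qed

lemma gaussian_integral:
  fixes x q d :: real
  assumes "x > 0" "q > 0"
  shows "has_bochner_integral lborel (\<lambda>u. exp (- ((x * u - d)\<^sup>2) / q)) (sqrt (pi * q) / x)"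
proof -
  have "has_bochner_integral lborel (\<lambda>u. complex_of_real (exp (- ((x * u - d)\<^sup>2) / q)))
     (complex_of_real (sqrt (pi * q) / x))"
    using gaussian_fourier[OF assms, of d 0] by (simp flip: exp_of_real)
  from has_bochner_integral_Re[OF this] show ?thesis by simp
qed

section \<open>Exponential integrals of Bessel type\<close>

lemma cosh_integral:
  fixes c :: real
  assumes "c > 0"
  shows "has_bochner_integral lborel (\<lambda>t. cosh (t / 2) * exp (- (2 * c * cosh t)))
           (sqrt (pi / c) * exp (- (2 * c)))"
proof -
  \<comment> \<open>\<open>cosh t = 1 + 2 (sinh (t / 2))\<^sup>2\<close>, so \<open>v = sinh (t / 2)\<close> turns this into a Gaussian integral.\<close>
  let ?f = "\<lambda>t::real. cosh (t / 2) * exp (- (2 * c * cosh t))"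
  let ?g = "\<lambda>v::real. 2 * arsinh v" and ?g' = "\<lambda>v::real. 2 / sqrt (v\<^sup>2 + 1)"
  \<comment> \<open>The factor \<open>cosh (t / 2) = sqrt (v\<^sup>2 + 1)\<close> cancels against
    the Jacobian of \<open>t = 2 * arsinh v\<close>.\<close>
  have fg: "?f (?g v) * ?g' v = (2 * exp (- (2 * c))) * exp (- ((2 * sqrt c * v - 0)\<^sup>2) / 1)" for v
  proof -
    have "cosh (2 * arsinh v) = 1 + 2 * v\<^sup>2"
      by (simp add: cosh_double cosh_square_eq)
    then have "?f (?g v) = sqrt (v\<^sup>2 + 1) * (exp (- (2 * c)) * exp (- (4 * c * v\<^sup>2)))"
      by (simp add: cosh_arsinh_real algebra_simps flip: exp_add)
    moreover have "sqrt (v\<^sup>2 + 1) \<noteq> 0"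
      by (smt (verit) real_sqrt_eq_zero_cancel_iff zero_le_power2)
    ultimately show ?thesis
      using assms by (simp add: power_mult_distrib)
  qed
  have int: "has_bochner_integral lborel (\<lambda>v. ?f (?g v) * ?g' v) (sqrt (pi / c) * exp (- (2 * c)))"
    unfolding fg
  proof -
    have "has_bochner_integral lborel (\<lambda>u. (2 * exp (- (2 * c))) * exp (- ((2 * sqrt c * u - 0)\<^sup>2) / 1))
        (2 * exp (- (2 * c)) * (sqrt (pi * 1) / (2 * sqrt c)))"
      by (intro has_bochner_integral_mult_right gaussian_integral) (use assms in auto)
    then show "has_bochner_integral lborel (\<lambda>u. (2 * exp (- (2 * c))) * exp (- ((2 * sqrt c * u - 0)\<^sup>2) / 1))
       (sqrt (pi / c) * exp (- (2 * c)))"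
      by (simp add: real_sqrt_divide mult.commute)
  qed
  have 1: "(?g has_real_derivative ?g' x) (at x)" for x
    by (auto intro!: derivative_eq_intros)
  have 2: "((ereal \<circ> ?g \<circ> real_of_ereal) \<longlongrightarrow> - \<infinity>) (at_right (- \<infinity>))"
    unfolding ereal_tendsto_simps
    by (rule filterlim_tendsto_pos_mult_at_bot[OF tendsto_const _ arsinh_real_at_bot]) simp
  have 3: "((ereal \<circ> ?g \<circ> real_of_ereal) \<longlongrightarrow> \<infinity>) (at_left \<infinity>)"
    unfolding ereal_tendsto_simps
    by (rule filterlim_tendsto_pos_mult_at_top[OF tendsto_const _ arsinh_real_at_top]) simp
  have 4: "set_integrable lborel (einterval (-\<infinity>) \<infinity>) (\<lambda>v. ?f (?g v) * ?g' v)"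
    using int by (simp add: has_bochner_integral_iff set_integrable_def)
  have 5: "isCont ?g' x" for x
    by (intro continuous_intros) (smt (verit) real_sqrt_eq_zero_cancel_iff zero_le_power2)
  have 6: "isCont ?f x" for x
    by (intro continuous_intros) auto
  note sub = interval_integral_substitution_nonneg[of "- \<infinity>" "\<infinity>" ?g ?g' ?f "- \<infinity>" "\<infinity>",
      OF _ 1 6 5 _ _ 2 3 4]
  show ?thesis
    using int sub unfolding has_bochner_integral_iff
    by (simp add: set_integrable_def interval_lebesgue_integral_def set_lebesgue_integral_def)
qed

text \<open>This is the integral representation of the modified Bessel function of order 1/2, which
  is elementary. It turns an integrand linear in \<open>A\<close> in the exponent into one with
  \<open>sqrt A\<close>, and so creates the square root of \<open>F2a_term\<close>.\<close>

lemma laplace_exp_integral: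
  fixes A B :: real
  assumes "A > 0" "B > 0"
  shows "has_bochner_integral lborel (\<lambda>s. exp (- s / 2 - A * exp s - B * exp (- s)))
           (sqrt (pi / B) * exp (- 2 * sqrt (A * B)))"
proof -
  \<comment> \<open>After centring, \<open>exp (-t / 2)\<close> may be replaced by its even part.\<close>
  define c where "c = sqrt (A * B)"
  have c: "c > 0"
    using assms by (simp add: c_def)
  let ?e = "\<lambda>t::real. exp (- (t / 2)) * exp (- (2 * c * cosh t))"
  let ?h = "\<lambda>t::real. cosh (t / 2) * exp (- (2 * c * cosh t))"
  have h: "has_bochner_integral lborel ?h (sqrt (pi / c) * exp (- (2 * c)))"
    by (rule cosh_integral[OF c])
  have e: "integrable lborel ?e"
  proof (rule Bochner_Integration.integrable_bound)
    show "integrable lborel (\<lambda>t. 2 * ?h t)"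
      using h by (simp add: has_bochner_integral_iff)
    show "AE t in lborel. norm (?e t) \<le> norm (2 * ?h t)"
      by (rule AE_I2) (simp add: cosh_def)
    have "?e \<in> borel_measurable borel"
      by (intro borel_measurable_continuous_onI continuous_intros) simp_all
    then show "?e \<in> borel_measurable lborel" by simp
  qed
  have e': "integrable lborel (\<lambda>t. ?e (- t))" "integral\<^sup>L lborel (\<lambda>t. ?e (- t)) = integral\<^sup>L lborel ?e"
    using lborel_integrable_real_affine[OF e, of "-1" 0] lborel_integral_real_affine[of "-1" ?e 0] by simp_all
  have "?e t + ?e (- t) = 2 * ?h t" for t
    by (simp add: cosh_def algebra_simps)
  then have "integral\<^sup>L lborel (\<lambda>t. ?e t + ?e (- t)) = 2 * (sqrt (pi / c) * exp (- (2 * c)))"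
    using h by (simp add: has_bochner_integral_iff)
  then have "has_bochner_integral lborel ?e (sqrt (pi / c) * exp (- (2 * c)))"
    using e e' by (simp add: has_bochner_integral_iff)
  then have *: "has_bochner_integral lborel (\<lambda>s. ?e (ln (A / c) + 1 * s)) (sqrt (pi / c) * exp (- (2 * c)))"
    by (subst (asm) lborel_has_bochner_integral_real_affine_iff[where c = 1 and t = "ln (A / c)"]) simp_all
  have AB: "A * B = c\<^sup>2"
    using assms by (simp add: c_def)
  \<comment> \<open>As \<open>A * B = c\<^sup>2\<close>, shifting by \<open>ln (A / c)\<close>
    splits \<open>2 * c * cosh\<close> into the unequal weights \<open>A\<close> and
    \<open>B\<close>. The factor \<open>sqrt (A / c)\<close> compensates for what the shift does to
    \<open>exp (- (t / 2))\<close>.\<close>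
  have eq: "sqrt (A / c) * ?e (ln (A / c) + 1 * s) = exp (- s / 2 - A * exp s - B * exp (- s))" for s
  proof -
    have l: "exp (ln (A / c)) = A / c" "exp (- ln (A / c)) = c / A"
      using assms c by (simp_all add: exp_minus)
    have "2 * c * cosh (ln (A / c) + 1 * s) = c * (A / c * exp s + c / A * exp (- s))"
      using l by (simp add: cosh_def exp_add exp_diff exp_minus field_simps)
    also have "\<dots> = A * exp s + B * exp (- s)"
      using assms c AB by (simp add: field_simps power2_eq_square)
    finally have 1: "2 * c * cosh (ln (A / c) + 1 * s) = A * exp s + B * exp (- s)" .
    have "sqrt (A / c) = exp (ln (A / c) / 2)"
      using assms c by (smt (verit) divide_pos_pos exp_ln ln_sqrt real_sqrt_gt_0_iff)
    then show ?thesis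
      unfolding 1 by (simp flip: exp_add add: algebra_simps diff_divide_distrib add_divide_distrib)
  qed
  have "sqrt (A / c) * (sqrt (pi / c) * exp (- (2 * c))) = sqrt (pi / B) * exp (- 2 * sqrt (A * B))"
  proof -
    have "A / c * (pi / c) = pi / B"
      using assms c AB by (simp add: field_simps power2_eq_square)
    then show ?thesis
      by (simp add: c_def flip: real_sqrt_mult)
  qed
  then show ?thesis
    using has_bochner_integral_mult_right[OF *, of "sqrt (A / c)"] unfolding eq by simp
qed

section \<open>Exchanging unordered sums with integrals\<close>

text \<open>Summability of a complex family is absolute summability, that is, integrability for
  counting measure. This makes Fubini's theorem available for \<open>infsum\<close>.\<close>

lemma infsum_lebesgue:
  fixes f :: "'i \<Rightarrow> complex"
  assumes "f summable_on UNIV"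
  shows "infsum f UNIV = integral\<^sup>L (count_space UNIV) f" "integrable (count_space UNIV) f"
proof -
  have "(\<lambda>x. norm (f x)) summable_on UNIV"
    using assms summable_on_iff_abs_summable_on_complex by blast
  then show "infsum f UNIV = integral\<^sup>L (count_space UNIV) f"
    using infsetsum_infsum[of f UNIV] abs_summable_equivalent[of f UNIV] by (simp add: infsetsum_def)
  show "integrable (count_space UNIV) f"
    using \<open>(\<lambda>x. norm (f x)) summable_on UNIV\<close> abs_summable_equivalent[of f UNIV] by (simp add: abs_summable_on_def)
qed

lemma borel_measurable_infsum_countable:
  fixes f :: "'i::countable \<Rightarrow> 'a \<Rightarrow> complex"
  assumes meas: "\<And>i. f i \<in> borel_measurable M" and summable: "\<And>x. (\<lambda>i. f i x) summable_on UNIV"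
  shows "(\<lambda>x. infsum (\<lambda>i. f i x) UNIV) \<in> borel_measurable M"
proof -
  interpret sigma_finite_measure "count_space (UNIV :: 'i set)"
    by (rule sigma_finite_measure_count_space_countable) simp
  have "(\<lambda>(i, x). f i x) \<in> borel_measurable (count_space UNIV \<Otimes>\<^sub>M M)"
    by (rule measurable_pair_measure_countable1) (use meas in auto)
  then have "(\<lambda>(x, i). f i x) \<in> borel_measurable (M \<Otimes>\<^sub>M count_space UNIV)"
    by (subst (asm) measurable_pair_swap_iff) simp
  then show ?thesis
    unfolding infsum_lebesgue(1)[OF summable] by (rule borel_measurable_lebesgue_integral)
qed

text \<open>Fubini's theorem on the product of counting measure and \<open>M\<close>: joint
  measurability comes from countability of the index type, and \<open>summable_norm\<close> is the
  integrability of the norm.\<close>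

lemma integral_infsum_swap:
  fixes f :: "'i::countable \<Rightarrow> 'a \<Rightarrow> complex"
  assumes "sigma_finite_measure M"
    and int: "\<And>i. integrable M (f i)"
    and summable: "\<And>x. (\<lambda>i. f i x) summable_on UNIV"
    and summable_norm: "(\<lambda>i. \<integral>x. norm (f i x) \<partial>M) summable_on UNIV"
  shows "(\<integral>x. infsum (\<lambda>i. f i x) UNIV \<partial>M) = infsum (\<lambda>i. integral\<^sup>L M (f i)) UNIV"
proof -
  interpret M: sigma_finite_measure M by fact
  interpret C: sigma_finite_measure "count_space (UNIV :: 'i set)"
    by (rule sigma_finite_measure_count_space_countable) simp
  interpret P: pair_sigma_finite "count_space (UNIV :: 'i set)" M ..
  have norm: "(\<lambda>i. norm (integral\<^sup>L M (f i))) summable_on UNIV"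
    by (rule summable_on_comparison_test[OF summable_norm]) auto
  then have s: "(\<lambda>i. integral\<^sup>L M (f i)) summable_on UNIV"
    using summable_on_iff_abs_summable_on_complex by blast
  \<comment> \<open>The detour through complex values is needed because
    \<open>infsum_lebesgue\<close> speaks of complex families only.\<close>
  have "integrable (count_space UNIV) (\<lambda>i. complex_of_real (\<integral>x. norm (f i x) \<partial>M))"
    by (rule infsum_lebesgue(2)) (use summable_norm summable_on_of_real in blast)
  then have "integrable (count_space UNIV) (\<lambda>i. \<integral>x. norm (f i x) \<partial>M)"
    using integrable_Re by force
  moreover have "(\<lambda>(i, x). f i x) \<in> borel_measurable (count_space UNIV \<Otimes>\<^sub>M M)"
    by (rule measurable_pair_measure_countable1) (use int in auto)
  ultimately have "integrable (count_space UNIV \<Otimes>\<^sub>M M) (\<lambda>(i, x). f i x)"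
    by (intro P.Fubini_integrable) (use int in auto)
  from P.Fubini_integral[OF this] show ?thesis
    unfolding infsum_lebesgue(1)[OF summable] infsum_lebesgue(1)[OF s] by simp
qed

section \<open>Invariance of Lebesgue measure under inversion\<close>

text \<open>For fixed \<open>u\<close> the map is a reflection and translation in \<open>s\<close>,
  and what remains is a reflection in \<open>u\<close>; both preserve Lebesgue measure. With
  \<open>g u = ln (1 + u\<^sup>2)\<close> the map is inversion in the coordinates of
  \<open>chart\<close>.\<close>

lemma integral_reflect_shear:
  fixes f :: "real \<times> real \<Rightarrow> complex"
  assumes f: "integrable (lborel \<Otimes>\<^sub>M lborel) f" and g [measurable]: "g \<in> borel_measurable borel"
  defines "T \<equiv> (\<lambda>(u, s). (- u, - s - g u))"
  shows "integrable (lborel \<Otimes>\<^sub>M lborel) (\<lambda>z. f (T z))"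
    and "integral\<^sup>L (lborel \<Otimes>\<^sub>M lborel) (\<lambda>z. f (T z)) = integral\<^sup>L (lborel \<Otimes>\<^sub>M lborel) f"
proof -
  have [measurable]: "f \<in> borel_measurable (borel \<Otimes>\<^sub>M borel)"
    using borel_measurable_integrable[OF f] by (simp cong: measurable_cong_sets)
  have fm: "(\<lambda>z. f (T z)) \<in> borel_measurable (lborel \<Otimes>\<^sub>M lborel)"
    unfolding T_def by measurable
  have T: "f (T (u, s)) = f (- u, - g u + (- 1) * s)" for u s
    by (simp add: T_def algebra_simps)
  have norm: "(\<integral>s. norm (f (T (u, s))) \<partial>lborel) = (\<integral>s. norm (f (- u, s)) \<partial>lborel)" for u
    unfolding T using lborel_integral_real_affine[of "- 1" "\<lambda>s. norm (f (- u, s))" "- g u"] by simp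
  have eq: "(\<integral>s. f (T (u, s)) \<partial>lborel) = (\<integral>s. f (- u, s) \<partial>lborel)" for u
    unfolding T using lborel_integral_real_affine[of "- 1" "\<lambda>s. f (- u, s)" "- g u"] by simp
  have "integrable lborel (\<lambda>u. \<integral>s. norm (f (u, s)) \<partial>lborel)"
    using lborel_pair.integrable_fst'[OF integrable_norm[OF f]] by simp
  from lborel_integrable_real_affine[OF this, of "- 1" 0]
  have 1: "integrable lborel (\<lambda>u. \<integral>s. norm (f (T (u, s))) \<partial>lborel)"
    unfolding norm by simp
  have "AE u in lborel. integrable lborel (\<lambda>s. f (u, s))"
    by (rule lborel_pair.AE_integrable_fst'[OF f])
  \<comment> \<open>The exceptional null set is reflected too, so \<open>lborel\<close> is rewritten
    as its own image under \<open>u \<mapsto> -u\<close>.\<close>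
  then have "AE u in lborel. integrable lborel (\<lambda>s. f (- u, s))"
    by (subst (asm) lborel_real_affine[of "- 1" 0]) (simp_all add: AE_density AE_distr_iff)
  then have 2: "AE u in lborel. integrable lborel (\<lambda>s. f (T (u, s)))"
    unfolding T by eventually_elim (rule lborel_integrable_real_affine, simp_all)
  show int: "integrable (lborel \<Otimes>\<^sub>M lborel) (\<lambda>z. f (T z))"
    by (rule lborel_pair.Fubini_integrable[OF fm 1 2])
  have "integral\<^sup>L (lborel \<Otimes>\<^sub>M lborel) (\<lambda>z. f (T z)) = (\<integral>u. \<integral>s. f (T (u, s)) \<partial>lborel \<partial>lborel)"
    by (rule lborel_pair.integral_fst'[OF int, symmetric])
  also have "\<dots> = (\<integral>u. \<integral>s. f (u, s) \<partial>lborel \<partial>lborel)"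
    unfolding eq using lborel_integral_real_affine[of "- 1" "\<lambda>u. \<integral>s. f (u, s) \<partial>lborel" 0] by simp
  also have "\<dots> = integral\<^sup>L (lborel \<Otimes>\<^sub>M lborel) f"
    by (rule lborel_pair.integral_fst'[OF f])
  finally show "integral\<^sup>L (lborel \<Otimes>\<^sub>M lborel) (\<lambda>z. f (T z)) = integral\<^sup>L (lborel \<Otimes>\<^sub>M lborel) f" .
qed

section \<open>Growth of modular invariant functions\<close>

text \<open>The series is easily estimated only away from the boundary \<open>Re z = 0\<close>.
  Invariance carries that estimate to the boundary, at the price of \<open>1 / Re z\<close> in the
  exponent.\<close>

lemma invariant_growth_bound:
  fixes F :: "complex \<Rightarrow> complex"
  assumes inv: "\<And>z. Re z > 0 \<Longrightarrow> F (1 / z) = F z"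
    and trans: "\<And>z. Re z > 0 \<Longrightarrow> F z = F (z + \<i>)"
    and bound: "\<And>z. Re z \<ge> 1 / 2 \<Longrightarrow> norm (F z) \<le> C * exp (b * Re z)"
    and nonneg: "C \<ge> 0" "b \<ge> 0"
    and pos: "Re z > 0"
  shows "norm (F z) \<le> C * exp (b * max (Re z) (1 / Re z))"
proof -
  have nat: "F (z + \<i> * of_nat n) = F z" if "Re z > 0" for z n
  proof (induction n)
    case (Suc n)
    then show ?case
      using trans[of "z + \<i> * of_nat n"] that by (simp add: algebra_simps)
  qed simp
  have int: "F (z + \<i> * of_int n) = F z" if "Re z > 0" for z n
  proof (cases "n \<ge> 0")
    case True
    then show ?thesis using nat[OF that, of "nat n"] by simp
  next
    case False
    then show ?thesis using nat[of "z + \<i> * of_int n" "nat (- n)"] that by simp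
  qed
  have mono: "C * exp (b * x) \<le> C * exp (b * y)" if "x \<le> y" for x y
    using that nonneg by (intro mult_left_mono) (auto intro: mult_left_mono)
  \<comment> \<open>Translating to \<open>|Im z| \<le> 1/2\<close> and inverting at least doubles \<open>Re z\<close> while it is below \<open>1/2\<close>,
    and never lifts it above \<open>1 / Re z\<close>.\<close>
  have "norm (F z) \<le> C * exp (b * max (Re z) (1 / Re z))" if "Re z > 0" "Re z \<ge> (1 / 2) ^ Suc k" for k z
    using that
  proof (induction k arbitrary: z)
    case 0
    then show ?case
      using bound[of z] mono[of "Re z" "max (Re z) (1 / Re z)"] by force
  next
    case (Suc k)
    show ?case
    proof (cases "Re z \<ge> 1 / 2")
      case True
      then show ?thesis
        using bound[of z] mono[of "Re z" "max (Re z) (1 / Re z)"] by force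
    next
      case False
      define w where "w = z + \<i> * of_int (- round (Im z))"
      have re: "Re w = Re z" and im: "\<bar>Im w\<bar> \<le> 1 / 2"
        unfolding w_def using of_int_round_abs_le[of "Im z"] by (auto simp: abs_minus_commute)
      \<comment> \<open>Since \<open>Re (1 / w)\<close> is \<open>Re w\<close> divided by the
        squared modulus of \<open>w\<close>, this bound on the modulus is what doubles the real
        part.\<close>
      have sq: "(Re w)\<^sup>2 + (Im w)\<^sup>2 \<le> 1 / 2"
      proof -
        have "(Re w)\<^sup>2 \<le> (1 / 2)\<^sup>2" "(Im w)\<^sup>2 \<le> (1 / 2)\<^sup>2"
          using re im False Suc.prems(1) by (auto intro: power_mono simp flip: abs_le_square_iff)
        then show ?thesis by (simp add: power2_eq_square)
      qed
      have rw: "Re (1 / w) = Re z / ((Re w)\<^sup>2 + (Im w)\<^sup>2)"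
        using re by (simp add: Re_divide)
      have p: "(Re w)\<^sup>2 + (Im w)\<^sup>2 > 0"
        using Suc.prems re by (simp add: sum_power2_gt_zero_iff)
      have lower: "Re (1 / w) \<ge> 2 * Re z"
        unfolding rw using p mult_left_mono[OF sq, of "2 * Re z"] Suc.prems(1) by (simp add: pos_le_divide_eq)
      have "Re z * Re z \<le> (Re w)\<^sup>2 + (Im w)\<^sup>2"
        by (simp add: re power2_eq_square)
      then have upper: "Re (1 / w) \<le> 1 / Re z"
        unfolding rw using p Suc.prems(1) by (simp add: divide_simps mult.commute)
      have "F z = F w"
        unfolding w_def by (rule int[OF Suc.prems(1), symmetric])
      also have "\<dots> = F (1 / w)"
        using inv[of w] re Suc.prems(1) by simp
      finally have "norm (F z) \<le> C * exp (b * max (Re (1 / w)) (1 / Re (1 / w)))"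
        using Suc.IH[of "1 / w"] lower Suc.prems by simp
      also have "\<dots> \<le> C * exp (b * max (Re z) (1 / Re z))"
      proof (rule mono)
        have "1 / Re (1 / w) \<le> 1 / Re z"
          using lower Suc.prems(1) by (intro divide_left_mono) auto
        then show "max (Re (1 / w)) (1 / Re (1 / w)) \<le> max (Re z) (1 / Re z)"
          using upper by auto
      qed
      finally show ?thesis .
    qed
  qed
  moreover obtain k where "(1 / 2) ^ k < Re z"
    using real_arch_pow_inv[of "Re z" "1 / 2"] pos by auto
  moreover have "(1 / 2 :: real) ^ Suc k \<le> (1 / 2) ^ k"
    by simp
  ultimately show ?thesis
    using pos by (meson less_imp_le order.trans)
qed

lemma norm_F2_term:
  "norm (F2_term \<Delta> a z (n, p)) = norm (a n p) * exp (- 2 * pi * (\<Delta> + real n) * Re z)"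
  by (simp add: F2_term_def norm_mult)

text \<open>Moving from \<open>1 / 2\<close> to \<open>z\<close> multiplies the norm of a term by
  \<open>exp (- 2 * pi * (\<Delta> + n) * (Re z - 1 / 2))\<close>. Here \<open>n\<close> only helps,
  so the factor is at most the stated exponential, uniformly in \<open>(n, p)\<close>.\<close>

lemma F2_bound:
  assumes "F2_term \<Delta> a (1 / 2) summable_on UNIV" "Re z \<ge> 1 / 2" "F2_term \<Delta> a z summable_on UNIV"
  shows "norm (F2 \<Delta> a z) \<le> infsum (\<lambda>i. norm (F2_term \<Delta> a (1 / 2) i)) UNIV * exp (2 * pi * max 0 (- \<Delta>) * Re z)"
proof -
  let ?e = "exp (2 * pi * max 0 (- \<Delta>) * Re z)"
  have 1: "(\<lambda>i. norm (F2_term \<Delta> a (1 / 2) i)) summable_on UNIV" "(\<lambda>i. norm (F2_term \<Delta> a z i)) summable_on UNIV"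
    using assms summable_on_iff_abs_summable_on_complex by blast+
  have le: "norm (F2_term \<Delta> a z i) \<le> norm (F2_term \<Delta> a (1 / 2) i) * ?e" for i
  proof (cases i)
    case (Pair n p)
    have "0 \<le> real n * (Re z - 1 / 2)"
      using assms by simp
    moreover have "- \<Delta> * (Re z - 1 / 2) \<le> max 0 (- \<Delta>) * (Re z - 1 / 2)"
      using assms by (intro mult_right_mono) auto
    moreover have "max 0 (- \<Delta>) * (Re z - 1 / 2) \<le> max 0 (- \<Delta>) * Re z"
      by (intro mult_left_mono) auto
    moreover have "- (\<Delta> + real n) * Re z + (\<Delta> + real n) * (1 / 2) = - \<Delta> * (Re z - 1 / 2) - real n * (Re z - 1 / 2)"
      by (simp add: algebra_simps)
    ultimately have "- (\<Delta> + real n) * Re z \<le> - (\<Delta> + real n) * (1 / 2) + max 0 (- \<Delta>) * Re z"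
      by linarith
    then have "2 * pi * (- (\<Delta> + real n) * Re z) \<le> 2 * pi * (- (\<Delta> + real n) * (1 / 2) + max 0 (- \<Delta>) * Re z)"
      by (intro mult_left_mono) auto
    also have "\<dots> = - 2 * pi * (\<Delta> + real n) * Re (1 / 2) + 2 * pi * max 0 (- \<Delta>) * Re z"
      by (simp add: distrib_left right_diff_distrib mult.assoc)
    also have "2 * pi * (- (\<Delta> + real n) * Re z) = - 2 * pi * (\<Delta> + real n) * Re z"
      by (simp add: algebra_simps)
    finally have "exp (- 2 * pi * (\<Delta> + real n) * Re z) \<le> exp (- 2 * pi * (\<Delta> + real n) * Re (1 / 2)) * ?e"
      by (subst exp_add[symmetric]) (simp only: exp_le_cancel_iff)
    from mult_left_mono[OF this norm_ge_zero[of "a n p"]] show ?thesis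
      unfolding Pair norm_F2_term by (simp only: mult.assoc)
  qed
  have "norm (F2 \<Delta> a z) \<le> infsum (\<lambda>i. norm (F2_term \<Delta> a z i)) UNIV"
    unfolding F2_def by (rule norm_infsum_bound[OF 1(2)])
  also have "\<dots> \<le> infsum (\<lambda>i. norm (F2_term \<Delta> a (1 / 2) i) * ?e) UNIV"
    by (rule infsum_mono) (use 1 le in \<open>auto intro: summable_on_cmult_left\<close>)
  also have "\<dots> = infsum (\<lambda>i. norm (F2_term \<Delta> a (1 / 2) i)) UNIV * ?e"
    by (rule infsum_cmult_left) (use 1 in auto)
  finally show ?thesis .
qed

section \<open>Half-plane coordinates and the Gaussian kernel\<close>

text \<open>
  In the coordinates \<open>z = e\<^sup>s (1 + iu)\<close> the measure \<open>dx dy / x\<^sup>2\<close> becomes \<open>ds du\<close>, and inversion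
  becomes the measure-preserving reflected shear of \<open>chart_inverse\<close>.
\<close>

definition chart :: "real \<Rightarrow> real \<Rightarrow> complex" where
  "chart u s = Complex (exp s) (exp s * u)"

lemma chart_simps [simp]: "Re (chart u s) = exp s" "Im (chart u s) = exp s * u"
  by (simp_all add: chart_def)

lemma chart_inverse: "chart (- u) (- s - ln (1 + u\<^sup>2)) = 1 / chart u s"
proof -
  have p: "1 + u\<^sup>2 > 0"
    by (smt (verit) zero_le_power2)
  have e: "exp (- s - ln (1 + u\<^sup>2)) = exp s / ((exp s)\<^sup>2 + (exp s * u)\<^sup>2)"
  proof -
    have "(exp s)\<^sup>2 + (exp s * u)\<^sup>2 = exp s * (exp s * (1 + u\<^sup>2))"
      by (simp add: algebra_simps power2_eq_square)
    moreover have "exp (- s - ln (1 + u\<^sup>2)) = 1 / (exp s * (1 + u\<^sup>2))"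
      using p by (simp add: exp_diff exp_minus divide_simps)
    ultimately show ?thesis
      by simp
  qed
  show ?thesis
    by (simp add: complex_eq_iff Re_divide Im_divide e)
qed

text \<open>The exponent is \<open>(1 - cosh r) / (2 * \<alpha>)\<close>, where \<open>r\<close> is
  the hyperbolic distance of \<open>z\<close> and \<open>w\<close> in the right half plane.\<close>

definition gauss_kernel :: "real \<Rightarrow> complex \<Rightarrow> complex \<Rightarrow> real" where
  "gauss_kernel \<alpha> z w = exp (- ((norm (z - w))\<^sup>2 / (4 * \<alpha> * Re z * Re w)))"

text \<open>Both sides depend only on \<open>norm (1 - z * w)\<close> and the product of the real
  parts, which is symmetric in \<open>z\<close> and \<open>w\<close>. In this form an inversion of
  the integration variable becomes an inversion of \<open>\<delta>\<close>.\<close>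

lemma gauss_kernel_inverse:
  assumes "Re z > 0" "Re w > 0"
  shows "gauss_kernel \<alpha> (1 / z) w = gauss_kernel \<alpha> z (1 / w)"
proof -
  have nz: "z \<noteq> 0" "w \<noteq> 0"
    using assms by auto
  have inv: "(norm (1 / x - y))\<^sup>2 / (4 * \<alpha> * Re (1 / x) * Re y) = (norm (1 - x * y))\<^sup>2 / (4 * \<alpha> * Re x * Re y)"
    if "x \<noteq> 0" for x y
  proof -
    have "1 / x - y = (1 - x * y) / x"
      using that by (simp add: field_simps)
    moreover have "Re (1 / x) = Re x / (norm x)\<^sup>2"
      by (simp add: Re_divide cmod_power2)
    ultimately show ?thesis
      using that by (simp add: norm_divide power_divide)
  qed
  show ?thesis
    using inv[OF nz(1), of w] inv[OF nz(2), of z]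
    by (simp add: gauss_kernel_def norm_minus_commute[of z] mult_ac)
qed

lemma gauss_kernel_chart:
  "gauss_kernel \<alpha> (chart u s) \<delta> = exp (- ((exp s - Re \<delta>)\<^sup>2 / (4 * \<alpha> * Re \<delta> * exp s))) *
     exp (- ((exp s * u - Im \<delta>)\<^sup>2) / (4 * \<alpha> * Re \<delta> * exp s))"
  by (simp add: gauss_kernel_def cmod_power2 add_divide_distrib mult_ac flip: exp_add)

text \<open>The left side is the radial part of the kernel times the Gaussian integral over
  \<open>u\<close>, the right side an integrand for \<open>laplace_exp_integral\<close>. The cross
  term of the square gives \<open>exp (1 / (2 * \<alpha>))\<close>, the origin of the
  \<open>- 1\<close> beside the square root in \<open>F2a_term\<close>.\<close>

lemma radial_weight:
  assumes "\<alpha> > 0" "d > 0"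
  shows "exp (- ((exp s - d)\<^sup>2 / (4 * \<alpha> * d * exp s))) * (sqrt (pi * (4 * \<alpha> * d * exp s)) / exp s)
    = sqrt (4 * pi * \<alpha> * d) * exp (1 / (2 * \<alpha>)) * exp (- s / 2 - 1 / (4 * \<alpha> * d) * exp s - d / (4 * \<alpha>) * exp (- s))"
proof -
  have "(exp s - d)\<^sup>2 / (4 * \<alpha> * d * exp s) = 1 / (4 * \<alpha> * d) * exp s + d / (4 * \<alpha>) * exp (- s) - 1 / (2 * \<alpha>)"
    using assms by (simp add: field_simps power2_eq_square exp_minus)
  then have 1: "exp (- ((exp s - d)\<^sup>2 / (4 * \<alpha> * d * exp s)))
      = exp (1 / (2 * \<alpha>)) * exp (- (1 / (4 * \<alpha> * d) * exp s) - d / (4 * \<alpha>) * exp (- s))"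
    by (simp flip: exp_add)
  have "sqrt (exp s) = exp (s / 2)"
    by (rule real_sqrt_unique) (simp_all add: power2_eq_square flip: exp_add)
  then have 2: "sqrt (pi * (4 * \<alpha> * d * exp s)) / exp s = sqrt (4 * pi * \<alpha> * d) * exp (- s / 2)"
  proof -
    have "pi * (4 * \<alpha> * d * exp s) = 4 * pi * \<alpha> * d * exp s"
      by simp
    then have "sqrt (pi * (4 * \<alpha> * d * exp s)) / exp s = sqrt (4 * pi * \<alpha> * d) * (exp (s / 2) / exp s)"
      by (simp only: real_sqrt_mult[of _ "exp s"] \<open>sqrt (exp s) = exp (s / 2)\<close> times_divide_eq_right)
    moreover have "exp (s / 2) / exp s = exp (- s / 2)"
      by (simp flip: exp_diff)
    ultimately show ?thesis by simp
  qed
  have 3: "exp (- s / 2 - 1 / (4 * \<alpha> * d) * exp s - d / (4 * \<alpha>) * exp (- s))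
      = exp (- s / 2) * exp (- (1 / (4 * \<alpha> * d) * exp s) - d / (4 * \<alpha>) * exp (- s))"
    by (simp flip: exp_add)
  show ?thesis
    unfolding 1 2 3 by (simp only: ac_simps)
qed

text \<open>Bounding the exponential of the maximum by a sum of two exponentials leaves two
  integrals of the type of \<open>laplace_exp_integral\<close>, one with \<open>A - b\<close> for
  \<open>A\<close> and one with \<open>B - b\<close> for \<open>B\<close>. The two conditions on
  \<open>b\<close> say that these differences are positive.\<close>

lemma gauss_kernel_integrable:
  fixes F :: "complex \<Rightarrow> complex"
  assumes meas: "(\<lambda>(u, s). F (chart u s)) \<in> borel_measurable (lborel \<Otimes>\<^sub>M lborel)"
    and bound: "\<And>z. Re z > 0 \<Longrightarrow> norm (F z) \<le> C * exp (b * max (Re z) (1 / Re z))"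
    and pos: "\<alpha> > 0" "Re \<delta> > 0" and b: "b < 1 / (4 * \<alpha> * Re \<delta>)" "b < Re \<delta> / (4 * \<alpha>)"
    and C: "C \<ge> 0"
  shows "integrable (lborel \<Otimes>\<^sub>M lborel) (\<lambda>(u, s). complex_of_real (gauss_kernel \<alpha> (chart u s) \<delta>) * F (chart u s))"
proof -
  let ?d = "Re \<delta>" let ?A = "1 / (4 * \<alpha> * ?d)" let ?B = "?d / (4 * \<alpha>)"
  let ?w = "\<lambda>s. exp (b * exp s) + exp (b * exp (- s))"
  \<comment> \<open>The order \<open>(s, u)\<close> lets Fubini's theorem integrate over
    \<open>u\<close> first; the coordinates are swapped back at the end.\<close>
  let ?G = "\<lambda>(s, u). C * ?w s * gauss_kernel \<alpha> (chart u s) \<delta>"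
  have kern_cont: "continuous_on UNIV (\<lambda>(s, u). gauss_kernel \<alpha> (chart u s) \<delta>)"
    unfolding gauss_kernel_chart split_def using pos by (intro continuous_intros) auto
  have [measurable]: "(\<lambda>(s, u). gauss_kernel \<alpha> (chart u s) \<delta>) \<in> borel_measurable (lborel \<Otimes>\<^sub>M lborel)"
    unfolding lborel_prod using borel_measurable_continuous_onI[OF kern_cont] by simp
  have G_meas: "?G \<in> borel_measurable (lborel \<Otimes>\<^sub>M lborel)"
    by measurable
  have kern_u: "has_bochner_integral lborel (\<lambda>u. gauss_kernel \<alpha> (chart u s) \<delta>)
     (sqrt (4 * pi * \<alpha> * ?d) * exp (1 / (2 * \<alpha>)) * exp (- s / 2 - ?A * exp s - ?B * exp (- s)))" for s
    unfolding gauss_kernel_chart radial_weight[OF pos, symmetric]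
    by (intro has_bochner_integral_mult_right gaussian_integral) (use pos in auto)
  let ?c = "C * (sqrt (4 * pi * \<alpha> * ?d) * exp (1 / (2 * \<alpha>)))"
  have G_int: "integrable (lborel \<Otimes>\<^sub>M lborel) ?G"
  proof (rule lborel_pair.Fubini_integrable[OF G_meas])
    have "(\<integral>u. norm (?G (s, u)) \<partial>lborel) = ?c * (exp (- s / 2 - (?A - b) * exp s - ?B * exp (- s))
        + exp (- s / 2 - ?A * exp s - (?B - b) * exp (- s)))" for s
    proof -
      have "norm (?G (s, u)) = ?G (s, u)" for u
        using C by (simp add: gauss_kernel_def abs_mult)
      then have "(\<integral>u. norm (?G (s, u)) \<partial>lborel) = C * ?w s *
          (sqrt (4 * pi * \<alpha> * ?d) * exp (1 / (2 * \<alpha>)) * exp (- s / 2 - ?A * exp s - ?B * exp (- s)))"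
        using kern_u[of s] by (simp add: has_bochner_integral_iff)
      also have "\<dots> = ?c * (?w s * exp (- s / 2 - ?A * exp s - ?B * exp (- s)))"
        by (simp only: ac_simps)
      also have "?w s * exp (- s / 2 - ?A * exp s - ?B * exp (- s)) = exp (- s / 2 - (?A - b) * exp s - ?B * exp (- s))
          + exp (- s / 2 - ?A * exp s - (?B - b) * exp (- s))"
        by (simp add: distrib_right left_diff_distrib algebra_simps flip: exp_add)
      finally show ?thesis .
    qed
    moreover have "integrable lborel (\<lambda>s. ?c * (exp (- s / 2 - (?A - b) * exp s - ?B * exp (- s))
        + exp (- s / 2 - ?A * exp s - (?B - b) * exp (- s))))"
      using laplace_exp_integral[of "?A - b" ?B] laplace_exp_integral[of ?A "?B - b"] b pos
      by (intro integrable_mult_right Bochner_Integration.integrable_add) (auto simp: has_bochner_integral_iff)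
    ultimately show "integrable lborel (\<lambda>s. \<integral>u. norm (?G (s, u)) \<partial>lborel)"
      by simp
    show "AE s in lborel. integrable lborel (\<lambda>u. ?G (s, u))"
      using kern_u by (auto simp: has_bochner_integral_iff)
  qed
  then have "integrable (lborel \<Otimes>\<^sub>M lborel) (\<lambda>(u, s). ?G (s, u))"
    by (rule lborel_pair.integrable_product_swap)
  then show ?thesis
  proof (rule Bochner_Integration.integrable_bound)
    have "(\<lambda>(u, s). gauss_kernel \<alpha> (chart u s) \<delta>) \<in> borel_measurable (lborel \<Otimes>\<^sub>M lborel)"
      by (subst measurable_pair_swap_iff) simp
    with meas show "(\<lambda>(u, s). complex_of_real (gauss_kernel \<alpha> (chart u s) \<delta>) * F (chart u s)) \<in> borel_measurable (lborel \<Otimes>\<^sub>M lborel)"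
      by (simp add: split_def)
    have "norm (complex_of_real (gauss_kernel \<alpha> (chart u s) \<delta>) * F (chart u s)) \<le> norm (?G (s, u))" for u s
    proof -
      have "norm (F (chart u s)) \<le> C * exp (b * max (exp s) (exp (- s)))"
        using bound[of "chart u s"] by (simp add: exp_minus inverse_eq_divide)
      also have "\<dots> \<le> C * ?w s"
        using C by (intro mult_left_mono) (auto simp: max_def)
      finally show ?thesis
        using C by (simp add: norm_mult abs_mult gauss_kernel_def mult.commute)
    qed
    then show "AE z in lborel \<Otimes>\<^sub>M lborel. norm (case z of (u, s) \<Rightarrow> complex_of_real (gauss_kernel \<alpha> (chart u s) \<delta>) * F (chart u s))
       \<le> norm (case z of (u, s) \<Rightarrow> ?G (s, u))"
      by (intro AE_I2) (simp only: split_def prod.case)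
  qed
qed

section \<open>Integral representation of \<open>F2a\<close> by \<open>F2\<close>\<close>

lemma F2_measurable:
  assumes "\<And>\<delta>. Re \<delta> > 0 \<Longrightarrow> F2_term \<Delta> a \<delta> summable_on UNIV"
  shows "(\<lambda>(u, s). F2 \<Delta> a (chart u s)) \<in> borel_measurable (lborel \<Otimes>\<^sub>M lborel)"
proof -
  have "(\<lambda>z. F2 \<Delta> a (chart (fst z) (snd z))) \<in> borel_measurable (borel :: (real \<times> real) measure)"
    unfolding F2_def
  proof (rule borel_measurable_infsum_countable)
    fix i
    show "(\<lambda>z. F2_term \<Delta> a (chart (fst z) (snd z)) i) \<in> borel_measurable borel"
      unfolding F2_term_def by (cases i, intro borel_measurable_continuous_onI)
        (auto intro!: continuous_intros)
  qed (simp add: assms)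
  then show ?thesis
    unfolding lborel_prod by (simp add: split_def)
qed

text \<open>
  The integral has to be iterated, with \<open>u\<close> inside: the decay in \<open>p\<close> that makes the sum converge
  appears only after the oscillating \<open>u\<close>-integral, so summability of \<open>F2a_term\<close> does not give
  absolute convergence jointly in \<open>(n, p, s, u)\<close>.
\<close>

lemma F2a_eq_iterated_integral:
  assumes conv: "\<And>\<delta>. Re \<delta> > 0 \<Longrightarrow> F2_term \<Delta> a \<delta> summable_on UNIV"
    and pos: "\<alpha> > 0" "Re \<delta> > 0" and positive: "1 + 8 * pi * \<Delta> * \<alpha> * Re \<delta> > 0"
    and summable: "F2a_term \<alpha> \<Delta> a \<delta> summable_on UNIV"
  shows "(\<integral>s. \<integral>u. complex_of_real (gauss_kernel \<alpha> (chart u s) \<delta>) * F2 \<Delta> a (chart u s) \<partial>lborel \<partial>lborel)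
     = complex_of_real (4 * pi * \<alpha>) * F2a \<alpha> \<Delta> a \<delta>"
proof -
  let ?d = "Re \<delta>" let ?B = "?d / (4 * \<alpha>)"
  \<comment> \<open>\<open>R\<close> is the radicand in \<open>F2a_term\<close>, and
    \<open>A\<close> the coefficient of \<open>- exp s\<close> in the exponent once \<open>u\<close>
    has been integrated out.\<close>
  define R where "R n p = 1 + 8 * pi * (\<Delta> + real n) * \<alpha> * ?d + (4 * pi * of_int p * \<alpha> * ?d)\<^sup>2" for n :: nat and p :: int
  define A where "A n p = R n p / (4 * \<alpha> * ?d)" for n p
  have R: "R n p > 0" for n p
  proof -
    have "R n p = (1 + 8 * pi * \<Delta> * \<alpha> * ?d) + 8 * pi * real n * \<alpha> * ?d + (4 * pi * of_int p * \<alpha> * ?d)\<^sup>2"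
      by (simp add: R_def algebra_simps)
    moreover have "8 * pi * real n * \<alpha> * ?d \<ge> 0"
      using pos by simp
    ultimately show ?thesis
      using positive by (smt (verit) zero_le_power2)
  qed
  let ?N = "sqrt (4 * pi * \<alpha> * ?d) * exp (1 / (2 * \<alpha>))"
  define L where "L = (\<lambda>(n, p) s. ?N * exp (- s / 2 - A n p * exp s - ?B * exp (- s)))"
  define ph where "ph = (\<lambda>(n::nat, p::int). a n p * exp (\<i> * complex_of_real (2 * pi * of_int p * Im \<delta>)))"
  let ?f = "\<lambda>i s u. complex_of_real (gauss_kernel \<alpha> (chart u s) \<delta>) * F2_term \<Delta> a (chart u s) i"

  have inner_term: "has_bochner_integral lborel (?f i s) (ph i * complex_of_real (L i s))" for i s
  proof (cases i)
    case (Pair n p)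
    let ?q = "4 * \<alpha> * ?d * exp s" and ?t = "2 * pi * real_of_int p"
    let ?r = "exp (- ((exp s - ?d)\<^sup>2 / (4 * \<alpha> * ?d * exp s)))"
    let ?e = "exp (- 2 * pi * (\<Delta> + real n) * exp s)"
    have q: "?q > 0" using pos by simp
    have "has_bochner_integral lborel
      (\<lambda>u. a n p * complex_of_real (?r * ?e) *
         exp (complex_of_real (- ((exp s * u - Im \<delta>)\<^sup>2) / ?q) + \<i> * complex_of_real (?t * (exp s * u))))
      (a n p * complex_of_real (?r * ?e) * (exp (\<i> * complex_of_real (?t * Im \<delta>)) *
         complex_of_real (sqrt (pi * ?q) / exp s * exp (- (?t\<^sup>2 * ?q / 4)))))"
      by (intro has_bochner_integral_mult_right gaussian_fourier q) simp
    moreover have "a n p * complex_of_real (?r * ?e) *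
         exp (complex_of_real (- ((exp s * u - Im \<delta>)\<^sup>2) / ?q) + \<i> * complex_of_real (?t * (exp s * u)))
         = ?f i s u" for u
    proof -
      have "\<i> * complex_of_real (?t * (exp s * u)) = 2 * complex_of_real pi * \<i> * of_int p * complex_of_real (Im (chart u s))"
        by simp
      then show ?thesis
        unfolding Pair F2_term_def gauss_kernel_chart prod.case exp_add
        by (simp add: mult_ac flip: exp_of_real)
    qed
    moreover have "a n p * complex_of_real (?r * ?e) * (exp (\<i> * complex_of_real (?t * Im \<delta>)) *
         complex_of_real (sqrt (pi * ?q) / exp s * exp (- (?t\<^sup>2 * ?q / 4)))) = ph i * complex_of_real (L i s)"
    proof -
      have "- 2 * pi * (\<Delta> + real n) * exp s + - (?t\<^sup>2 * ?q / 4) + (- s / 2 - 1 / (4 * \<alpha> * ?d) * exp s - ?B * exp (- s))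
          = - s / 2 - A n p * exp s - ?B * exp (- s)"
        using pos by (simp add: A_def R_def field_simps power2_eq_square)
      then have e: "?e * exp (- (?t\<^sup>2 * ?q / 4)) * exp (- s / 2 - 1 / (4 * \<alpha> * ?d) * exp s - ?B * exp (- s))
          = exp (- s / 2 - A n p * exp s - ?B * exp (- s))"
        by (simp only: exp_add[symmetric])
      have "?r * ?e * (sqrt (pi * ?q) / exp s * exp (- (?t\<^sup>2 * ?q / 4)))
          = ?r * (sqrt (pi * ?q) / exp s) * (?e * exp (- (?t\<^sup>2 * ?q / 4)))"
        by (simp only: ac_simps)
      also have "\<dots> = ?N * (?e * exp (- (?t\<^sup>2 * ?q / 4)) * exp (- s / 2 - 1 / (4 * \<alpha> * ?d) * exp s - ?B * exp (- s)))"
        unfolding radial_weight[OF pos] by (simp only: ac_simps)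
      also have "\<dots> = L i s"
        unfolding e Pair L_def prod.case ..
      finally have "?r * ?e * (sqrt (pi * ?q) / exp s * exp (- (?t\<^sup>2 * ?q / 4))) = L i s" .
      then show ?thesis
        unfolding Pair ph_def prod.case by (simp only: of_real_mult[symmetric] mult_ac)
    qed
    ultimately show ?thesis by simp
  qed

  \<comment> \<open>Here \<open>A n p * ?B = R n p / (4 * \<alpha>)\<^sup>2\<close>, so
    \<open>laplace_exp_integral\<close> yields exactly the exponent of \<open>F2a_term\<close>; the
    remaining constants combine to \<open>4 * pi * \<alpha>\<close>.\<close>
  have L_int: "has_bochner_integral lborel (L i) (4 * pi * \<alpha> * exp (- (1 / (2 * \<alpha>)) * (sqrt (R (fst i) (snd i)) - 1)))" for i
  proof (cases i)
    case (Pair n p)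
    have hbi: "has_bochner_integral lborel (L i) (?N * (sqrt (pi / ?B) * exp (- 2 * sqrt (A n p * ?B))))"
      unfolding Pair L_def prod.case
      by (intro has_bochner_integral_mult_right laplace_exp_integral) (use pos R in \<open>auto simp: A_def\<close>)
    have 1: "sqrt (4 * pi * \<alpha> * ?d) * sqrt (pi / ?B) = 4 * pi * \<alpha>"
    proof -
      have "4 * pi * \<alpha> * ?d * (pi / ?B) = (4 * pi * \<alpha>)\<^sup>2"
        using pos by (simp add: field_simps power2_eq_square)
      then show ?thesis
        using pos by (simp flip: real_sqrt_mult)
    qed
    have "sqrt (A n p * ?B) = sqrt (R n p) / (4 * \<alpha>)"
    proof -
      have "A n p * ?B = R n p / (4 * \<alpha>)\<^sup>2"
        using pos by (simp add: A_def power2_eq_square)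
      moreover have "sqrt ((4 * \<alpha>)\<^sup>2) = 4 * \<alpha>"
        using pos by (intro real_sqrt_unique) auto
      ultimately show ?thesis
        by (simp only: real_sqrt_divide)
    qed
    then have 2: "exp (1 / (2 * \<alpha>)) * exp (- 2 * sqrt (A n p * ?B)) = exp (- (1 / (2 * \<alpha>)) * (sqrt (R n p) - 1))"
      using pos by (simp add: field_simps flip: exp_add)
    have "?N * (sqrt (pi / ?B) * exp (- 2 * sqrt (A n p * ?B)))
        = (sqrt (4 * pi * \<alpha> * ?d) * sqrt (pi / ?B)) * (exp (1 / (2 * \<alpha>)) * exp (- 2 * sqrt (A n p * ?B)))"
      by (simp only: ac_simps)
    with hbi show ?thesis
      unfolding 1 2 Pair fst_conv snd_conv by (simp only:)
  qed
  have F2a_term: "ph i * complex_of_real (exp (- (1 / (2 * \<alpha>)) * (sqrt (R (fst i) (snd i)) - 1))) = F2a_term \<alpha> \<Delta> a \<delta> i" for i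
  proof (cases i)
    case (Pair n p)
    have "\<i> * complex_of_real (2 * pi * of_int p * Im \<delta>) = 2 * complex_of_real pi * \<i> * of_int p * complex_of_real (Im \<delta>)"
      by simp
    then show ?thesis
      unfolding Pair F2a_term_def ph_def R_def prod.case exp_add fst_conv snd_conv exp_of_real by (simp only: ac_simps)
  qed
  have L_nonneg: "L i s \<ge> 0" for i s
    using pos by (cases i) (simp add: L_def)

  \<comment> \<open>The norm of \<open>F2_term\<close> depends only on the real part
    \<open>exp s\<close>, hence not on \<open>u\<close>, so the integral factors and convergence of
    \<open>F2\<close> at the real point \<open>exp s\<close> suffices.\<close>
  have norm_sum: "(\<lambda>i. \<integral>u. norm (?f i s u) \<partial>lborel) summable_on UNIV" for s
  proof -
    have "(\<integral>u. norm (?f i s u) \<partial>lborel) = (\<integral>u. gauss_kernel \<alpha> (chart u s) \<delta> \<partial>lborel) * norm (F2_term \<Delta> a (complex_of_real (exp s)) i)" for i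
    proof (cases i)
      case (Pair n p)
      have "norm (?f i s u) = gauss_kernel \<alpha> (chart u s) \<delta> * norm (F2_term \<Delta> a (complex_of_real (exp s)) i)" for u
        unfolding Pair by (simp add: norm_mult norm_F2_term gauss_kernel_def del: of_real_exp)
      then show ?thesis by simp
    qed
    moreover have "(\<lambda>i. norm (F2_term \<Delta> a (complex_of_real (exp s)) i)) summable_on UNIV"
    proof -
      have "F2_term \<Delta> a (complex_of_real (exp s)) summable_on UNIV"
        by (rule conv) (simp del: of_real_exp)
      then show ?thesis
        using summable_on_iff_abs_summable_on_complex by blast
    qed
    ultimately show ?thesis
      by (simp add: summable_on_cmult_right)
  qed
  have inner: "(\<integral>u. complex_of_real (gauss_kernel \<alpha> (chart u s) \<delta>) * F2 \<Delta> a (chart u s) \<partial>lborel)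
       = infsum (\<lambda>i. ph i * complex_of_real (L i s)) UNIV" for s
  proof -
    have "(\<integral>u. complex_of_real (gauss_kernel \<alpha> (chart u s) \<delta>) * F2 \<Delta> a (chart u s) \<partial>lborel)
        = (\<integral>u. infsum (\<lambda>i. ?f i s u) UNIV \<partial>lborel)"
      unfolding F2_def by (simp add: infsum_cmult_right conv)
    also have "\<dots> = infsum (\<lambda>i. integral\<^sup>L lborel (?f i s)) UNIV"
      using inner_term norm_sum
      by (intro integral_infsum_swap lborel.sigma_finite_measure_axioms)
        (auto simp: has_bochner_integral_iff intro!: summable_on_cmult_right conv)
    also have "\<dots> = infsum (\<lambda>i. ph i * complex_of_real (L i s)) UNIV"
      using inner_term by (simp add: has_bochner_integral_iff)
    finally show ?thesis .
  qed
  have outer_summable: "(\<lambda>i. ph i * complex_of_real (L i s)) summable_on UNIV" for s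
  proof -
    have "norm (ph i * complex_of_real (L i s)) \<le> (\<integral>u. norm (?f i s u) \<partial>lborel)" for i
      using inner_term[where i = i and s = s] integral_norm_bound[of lborel "?f i s"] by (simp add: has_bochner_integral_iff)
    then have "(\<lambda>i. norm (ph i * complex_of_real (L i s))) summable_on UNIV"
      by (intro summable_on_comparison_test[OF norm_sum[of s]]) auto
    then show ?thesis
      using summable_on_iff_abs_summable_on_complex by blast
  qed
  have term_int: "has_bochner_integral lborel (\<lambda>s. ph i * complex_of_real (L i s)) (complex_of_real (4 * pi * \<alpha>) * F2a_term \<alpha> \<Delta> a \<delta> i)" for i
  proof -
    have "has_bochner_integral lborel (\<lambda>s. complex_of_real (L i s))
       (complex_of_real (4 * pi * \<alpha> * exp (- (1 / (2 * \<alpha>)) * (sqrt (R (fst i) (snd i)) - 1))))"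
      by (rule has_bochner_integral_of_real[OF L_int])
    from has_bochner_integral_mult_right[OF this, of "ph i"] show ?thesis
      unfolding F2a_term[symmetric] of_real_mult[of "4 * pi * \<alpha>"] by (simp only: mult.left_commute)
  qed
  \<comment> \<open>The phase \<open>ph i\<close> is free of \<open>s\<close> and \<open>L\<close>
    is nonnegative, so nothing cancels in the \<open>s\<close>-integral. Summability of
    \<open>F2a_term\<close> is thus the condition for the second exchange.\<close>
  have "(\<integral>s. norm (ph i * complex_of_real (L i s)) \<partial>lborel) = 4 * pi * \<alpha> * norm (F2a_term \<alpha> \<Delta> a \<delta> i)" for i
    unfolding F2a_term[symmetric] norm_mult norm_of_real
    using L_int[of i] L_nonneg by (simp add: has_bochner_integral_iff)
  moreover have "(\<lambda>i. norm (F2a_term \<alpha> \<Delta> a \<delta> i)) summable_on UNIV"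
    using summable summable_on_iff_abs_summable_on_complex by blast
  ultimately have "(\<lambda>i. \<integral>s. norm (ph i * complex_of_real (L i s)) \<partial>lborel) summable_on UNIV"
    by (simp add: summable_on_cmult_right)
  then have "(\<integral>s. infsum (\<lambda>i. ph i * complex_of_real (L i s)) UNIV \<partial>lborel)
      = infsum (\<lambda>i. \<integral>s. ph i * complex_of_real (L i s) \<partial>lborel) UNIV"
    using term_int outer_summable
    by (intro integral_infsum_swap lborel.sigma_finite_measure_axioms) (auto simp: has_bochner_integral_iff)
  also have "\<dots> = infsum (\<lambda>i. complex_of_real (4 * pi * \<alpha>) * F2a_term \<alpha> \<Delta> a \<delta> i) UNIV"
    using term_int by (simp add: has_bochner_integral_iff)
  also have "\<dots> = complex_of_real (4 * pi * \<alpha>) * F2a \<alpha> \<Delta> a \<delta>"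
    unfolding F2a_def using summable by (simp add: infsum_cmult_right)
  finally show ?thesis
    unfolding inner .
qed

section \<open>Invariance of \<open>F2a\<close> under translation and inversion\<close>

theorem mainTheorem4:
  fixes \<Delta> \<alpha> :: real and a :: "nat \<Rightarrow> int \<Rightarrow> complex"
  assumes real_form: "\<And>n p. a n p = cnj (a n (- p))"
    and converges: "\<And>\<delta>. Re \<delta> > 0 \<Longrightarrow> F2_term \<Delta> a \<delta> summable_on UNIV"
    and modular: "\<And>\<delta>. Re \<delta> > 0 \<Longrightarrow>
                    F2 \<Delta> a (1 / \<delta>) = F2 \<Delta> a \<delta> \<and> F2 \<Delta> a \<delta> = F2 \<Delta> a (\<delta> + \<i>)"
    and alpha_pos: "\<alpha> > 0"
  shows "\<forall>\<delta> \<in> F2a_domain \<alpha> \<Delta>.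
           F2a_term \<alpha> \<Delta> a \<delta> summable_on UNIV \<longrightarrow>
             (F2a_term \<alpha> \<Delta> a (1 / \<delta>) summable_on UNIV \<longrightarrow> F2a \<alpha> \<Delta> a (1 / \<delta>) = F2a \<alpha> \<Delta> a \<delta>) \<and>
             F2a_term \<alpha> \<Delta> a (\<delta> + \<i>) summable_on UNIV \<and> F2a \<alpha> \<Delta> a \<delta> = F2a \<alpha> \<Delta> a (\<delta> + \<i>)"
proof (intro ballI impI conjI)
  fix \<delta>
  assume dom: "\<delta> \<in> F2a_domain \<alpha> \<Delta>" and summable: "F2a_term \<alpha> \<Delta> a \<delta> summable_on UNIV"
  have pos: "Re \<delta> > 0"
    and strip: "\<Delta> < 0 \<Longrightarrow> 8 * pi * \<bar>\<Delta>\<bar> * \<alpha> < Re \<delta>" "\<Delta> < 0 \<Longrightarrow> Re \<delta> < inverse (8 * pi * \<bar>\<Delta>\<bar> * \<alpha>)"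
    using dom by (auto simp: F2a_domain_def)
  have shift: "F2a_term \<alpha> \<Delta> a (\<delta> + \<i>) = F2a_term \<alpha> \<Delta> a \<delta>"
  proof
    fix i :: "nat \<times> int"
    obtain n p where i: "i = (n, p)" by (cases i)
    have "exp (2 * complex_of_real pi * \<i> * of_int p) = 1"
      using exp_integer_2pi[of "of_int p"] by (simp add: mult_ac)
    then have "exp (x + 2 * complex_of_real pi * \<i> * of_int p * complex_of_real (Im (\<delta> + \<i>)))
        = exp (x + 2 * complex_of_real pi * \<i> * of_int p * complex_of_real (Im \<delta>))" for x
      by (simp add: distrib_left exp_add)
    moreover have "Re (\<delta> + \<i>) = Re \<delta>"
      by simp
    ultimately show "F2a_term \<alpha> \<Delta> a (\<delta> + \<i>) i = F2a_term \<alpha> \<Delta> a \<delta> i"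
      unfolding i F2a_term_def prod.case by (simp only:)
  qed
  show "F2a_term \<alpha> \<Delta> a (\<delta> + \<i>) summable_on UNIV" "F2a \<alpha> \<Delta> a \<delta> = F2a \<alpha> \<Delta> a (\<delta> + \<i>)"
    using summable by (simp_all add: shift F2a_def)
  assume summable': "F2a_term \<alpha> \<Delta> a (1 / \<delta>) summable_on UNIV"
  \<comment> \<open>\<open>D\<close> treats both signs of \<open>\<Delta>\<close> at once: the strip
    condition becomes the two inequalities below, which are trivial or follow from
    \<open>Re \<delta> > 0\<close> when \<open>D = 0\<close>.\<close>
  define D where "D = max 0 (- \<Delta>)"
  have D: "8 * pi * D * \<alpha> < Re \<delta>" "8 * pi * D * \<alpha> * Re \<delta> < 1"
  proof -
    show "8 * pi * D * \<alpha> < Re \<delta>"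
      using strip(1) pos by (cases "\<Delta> < 0") (auto simp: D_def)
    show "8 * pi * D * \<alpha> * Re \<delta> < 1"
    proof (cases "\<Delta> < 0")
      case True
      then have "8 * pi * \<bar>\<Delta>\<bar> * \<alpha> > 0"
        using alpha_pos by (intro mult_pos_pos) auto
      then show ?thesis
        using strip(2)[OF True] True by (simp add: D_def field_simps)
    qed (simp add: D_def)
  qed
  have pos': "Re (1 / \<delta>) > 0"
    using pos by (simp add: Re_divide sum_power2_gt_zero_iff)
  \<comment> \<open>The point \<open>1 / \<delta>\<close> may leave the strip, but the lower bound
    on \<open>Re \<delta>\<close> still keeps the radicands positive there.\<close>
  have D': "8 * pi * D * \<alpha> * Re (1 / \<delta>) < 1"
  proof -
    have "(Re \<delta>)\<^sup>2 + (Im \<delta>)\<^sup>2 > 0"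
      using pos by (simp add: sum_power2_gt_zero_iff)
    then have "Re (1 / \<delta>) \<le> 1 / Re \<delta>"
      using pos by (simp add: Re_divide divide_simps power2_eq_square)
    moreover have "8 * pi * D * \<alpha> \<ge> 0"
      using alpha_pos by (simp add: D_def)
    ultimately have "8 * pi * D * \<alpha> * Re (1 / \<delta>) \<le> 8 * pi * D * \<alpha> * (1 / Re \<delta>)"
      by (rule mult_left_mono)
    also have "\<dots> < 1"
      using D(1) pos by simp
    finally show ?thesis .
  qed
  have positive: "1 + 8 * pi * \<Delta> * \<alpha> * x > 0" if "8 * pi * D * \<alpha> * x < 1" "x > 0" for x
  proof -
    have "8 * pi * \<alpha> * x * (- \<Delta>) \<le> 8 * pi * \<alpha> * x * D"
      using that alpha_pos by (intro mult_left_mono) (auto simp: D_def)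
    then show ?thesis
      using that by (simp add: mult_ac)
  qed

  define C where "C = infsum (\<lambda>i. norm (F2_term \<Delta> a (1 / 2) i)) UNIV"
  have C: "C \<ge> 0"
    unfolding C_def by (rule infsum_nonneg) simp
  have growth: "norm (F2 \<Delta> a z) \<le> C * exp (2 * pi * D * max (Re z) (1 / Re z))" if "Re z > 0" for z
  proof (rule invariant_growth_bound[OF _ _ _ C _ that])
    show "norm (F2 \<Delta> a z) \<le> C * exp (2 * pi * D * Re z)" if "Re z \<ge> 1 / 2" for z
      unfolding C_def D_def by (rule F2_bound) (use that in \<open>auto intro: converges\<close>)
    show "2 * pi * D \<ge> 0"
      by (simp add: D_def)
  qed (use modular in blast)+

  define H where "H \<delta> = (\<lambda>(u, s). complex_of_real (gauss_kernel \<alpha> (chart u s) \<delta>) * F2 \<Delta> a (chart u s))" for \<delta>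
  have int: "integrable (lborel \<Otimes>\<^sub>M lborel) (H \<delta>)"
    unfolding H_def
  proof (rule gauss_kernel_integrable[where F = "F2 \<Delta> a", OF F2_measurable[OF converges] growth alpha_pos pos _ _ C])
    \<comment> \<open>The upper end of the strip controls the kernel at large \<open>Re z\<close>,
      the lower end at small \<open>Re z\<close>.\<close>
    show "2 * pi * D < 1 / (4 * \<alpha> * Re \<delta>)"
      using D(2) alpha_pos pos by (simp add: pos_less_divide_eq mult_ac)
    show "2 * pi * D < Re \<delta> / (4 * \<alpha>)"
      using D(1) alpha_pos by (simp add: pos_less_divide_eq mult_ac)
  qed
  \<comment> \<open>In the chart the map is inversion of the integration variable: \<open>F2\<close>
    absorbs it, and the kernel passes it on to \<open>\<delta>\<close>.\<close>
  have "H \<delta> (case z of (u, s) \<Rightarrow> (- u, - s - ln (1 + u\<^sup>2))) = H (1 / \<delta>) z" for z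
  proof (cases z)
    case (Pair u s)
    have "F2 \<Delta> a (1 / chart u s) = F2 \<Delta> a (chart u s)"
      using modular[of "chart u s"] by simp
    then show ?thesis
      using pos by (simp add: Pair H_def chart_inverse gauss_kernel_inverse)
  qed
  \<comment> \<open>Integrability at \<open>1 / \<delta>\<close> is transported from
    \<open>\<delta>\<close>, since the conditions of \<open>gauss_kernel_integrable\<close> may fail
    at \<open>1 / \<delta>\<close>.\<close>
  then have int': "integrable (lborel \<Otimes>\<^sub>M lborel) (H (1 / \<delta>))"
    and eq: "integral\<^sup>L (lborel \<Otimes>\<^sub>M lborel) (H (1 / \<delta>)) = integral\<^sup>L (lborel \<Otimes>\<^sub>M lborel) (H \<delta>)"
    using integral_reflect_shear[OF int, of "\<lambda>u. ln (1 + u\<^sup>2)"] by simp_all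
  have F2a: "complex_of_real (4 * pi * \<alpha>) * F2a \<alpha> \<Delta> a w = integral\<^sup>L (lborel \<Otimes>\<^sub>M lborel) (H w)"
    if "Re w > 0" "8 * pi * D * \<alpha> * Re w < 1" "F2a_term \<alpha> \<Delta> a w summable_on UNIV"
      "integrable (lborel \<Otimes>\<^sub>M lborel) (H w)" for w
  proof -
    have "complex_of_real (4 * pi * \<alpha>) * F2a \<alpha> \<Delta> a w = (\<integral>s. \<integral>u. H w (u, s) \<partial>lborel \<partial>lborel)"
      using F2a_eq_iterated_integral[OF converges alpha_pos that(1) positive[OF that(2,1)] that(3)]
      by (simp add: H_def)
    \<comment> \<open>Joint integrability of \<open>H w\<close> turns the iterated integral into the
      double integral, on which inversion acts.\<close>
    also have "\<dots> = integral\<^sup>L (lborel \<Otimes>\<^sub>M lborel) (H w)"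
      using lborel_pair.integral_snd[of "\<lambda>u s. H w (u, s)"] that(4) by (simp add: case_prod_eta)
    finally show ?thesis .
  qed
  have "complex_of_real (4 * pi * \<alpha>) * F2a \<alpha> \<Delta> a (1 / \<delta>) = complex_of_real (4 * pi * \<alpha>) * F2a \<alpha> \<Delta> a \<delta>"
    unfolding F2a[OF pos D(2) summable int] F2a[OF pos' D' summable' int'] by (rule eq)
  moreover have "complex_of_real (4 * pi * \<alpha>) \<noteq> 0"
    using alpha_pos by simp
  ultimately show "F2a \<alpha> \<Delta> a (1 / \<delta>) = F2a \<alpha> \<Delta> a \<delta>"
    by (metis mult_cancel_left)
qed

end
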